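(* Let $\Pi=\mathbb{R}/\mathbb{Z}$ be the circle, let $\sigma,b\in C^2(\Pi)$ with $a:=\sigma^2/2>0$, and assume that $b$ is separated from $0$ on $\Pi$ (i.e. $b(x)\ne0$ for all $x\in\Pi$). Set $$\omega(s):=\frac{1}{b(s)}\Big/\int_0^1\frac{1}{b(u)}\,du ,$$ and for $\epsilon>0$ and a probability measure $\mu$ on $\Pi$ let $$I_\epsilon(\mu):=\sup_{u\in C^2(\Pi),\,u>0}\;-\int_\Pi\frac{\epsilon\,a\,u''+b\,u'}{u}\,d\mu .$$ Then for every probability measure $\mu$ on $\Pi$ the limit $I(\mu):=\lim_{\epsilon\to0}I_\epsilon(\mu)$ exists in $[0,+\infty]$ and $$I(\mu)=\begin{cases}0&\text{if }\mu=\omega\,ds,\\ +\infty&\text{otherwise.}\end{cases}$$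
   Context: All objects are defined in the claim. *)

theory Defs
  imports "HOL-Probability.Probability"
begin

(* A function on the circle R/Z is represented by its 1-periodic lift to the real line;
   derivatives along the circle are the derivatives of the lift. *)
definition C2_circle :: "(real \<Rightarrow> real) \<Rightarrow> bool" where
  "C2_circle f \<longleftrightarrow>
     (\<forall>x. f (x + 1) = f x) \<and>
     (\<forall>x. f differentiable (at x)) \<and>
     (\<forall>x. deriv f differentiable (at x)) \<and>
     continuous_on UNIV (deriv (deriv f))"

(* The quotient map R -> R/Z restricts to a Borel isomorphism from the fundamental domain
   [0,1) onto the circle.  Borel measures on the circle are therefore represented by Borel
   measures on [0,1), and the uniform measure ds by Lebesgue measure there. *)
definition circle_borel :: "real measure" where
  "circle_borel = restrict_space borel {0..<1}"

definition circle_lebesgue :: "real measure" where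
  "circle_lebesgue = restrict_space lborel {0..<1}"

definition prob_measure_circle :: "real measure \<Rightarrow> bool" where
  "prob_measure_circle \<mu> \<longleftrightarrow> prob_space \<mu> \<and> sets \<mu> = sets circle_borel"

definition omega :: "(real \<Rightarrow> real) \<Rightarrow> real \<Rightarrow> real" where
  "omega b s = (1 / b s) / (LBINT u:{0..1}. 1 / b u)"

(* For a and b continuous and \<mu> a probability measure on the circle, the integrand below is
   continuous and periodic, hence bounded, so the Bochner integral is a genuine integral. *)
definition I_eps ::
    "(real \<Rightarrow> real) \<Rightarrow> (real \<Rightarrow> real) \<Rightarrow> real \<Rightarrow> real measure \<Rightarrow> ereal" where
  "I_eps a b \<epsilon> \<mu> =
     (SUP u\<in>{u. C2_circle u \<and> (\<forall>x. u x > 0)}.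
        ereal (- (LINT x|\<mu>. (\<epsilon> * a x * deriv (deriv u) x + b x * deriv u x) / u x)))"

definition I_lim :: "(real \<Rightarrow> real) \<Rightarrow> (real \<Rightarrow> real) \<Rightarrow> real measure \<Rightarrow> ereal" where
  "I_lim a b \<mu> = Lim (at_right 0) (\<lambda>\<epsilon>. I_eps a b \<epsilon> \<mu>)"

end

theory Submission
  imports Defs
begin

text \<open>Against \<open>\<omega> ds\<close>, integrating by parts and completing the square bounds the functional
  by \<open>\<epsilon> K\<close> uniformly in \<open>u\<close>, and \<open>u = 1\<close> gives \<open>I_eps \<ge> 0\<close>.  Any other \<open>\<mu>\<close> satisfies
  \<open>\<integral> b \<phi>' d\<mu> = k \<noteq> 0\<close> for some \<open>\<phi>\<close>, and \<open>u = exp (\<lambda> \<phi>)\<close> yields the lower bound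
  \<open>- \<lambda> k + O(\<epsilon>)\<close> with \<open>\<lambda>\<close> arbitrary.\<close>

section \<open>Periodic functions and integrability on the circle\<close>

lemma periodic_deriv:
  fixes f :: "real \<Rightarrow> real"
  assumes "\<And>x. f (x + 1) = f x"
  shows "deriv f (x + 1) = deriv f x"
  using assms by (simp add: deriv_def DERIV_shift)

lemma C2_circleD:
  assumes "C2_circle f"
  shows "f (x + 1) = f x"
    and "(f has_real_derivative deriv f x) (at x)"
    and "(deriv f has_real_derivative deriv (deriv f) x) (at x)"
    and "continuous_on A f"
    and "continuous_on A (deriv f)"
    and "continuous_on A (deriv (deriv f))"
proof -
  show "f (x + 1) = f x"
    using assms by (simp add: C2_circle_def)
  show f: "(f has_real_derivative deriv f x) (at x)" for x
    using assms by (simp add: C2_circle_def DERIV_deriv_iff_real_differentiable)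
  show f': "(deriv f has_real_derivative deriv (deriv f) x) (at x)" for x
    using assms by (simp add: C2_circle_def DERIV_deriv_iff_real_differentiable)
  show "continuous_on A f"
    by (meson DERIV_isCont continuous_at_imp_continuous_on f)
  show "continuous_on A (deriv f)"
    by (meson DERIV_isCont continuous_at_imp_continuous_on f')
  show "continuous_on A (deriv (deriv f))"
    using assms continuous_on_subset by (auto simp: C2_circle_def)
qed

lemma C2_circleI:
  assumes "\<And>x. f (x + 1) = f x"
    and f': "\<And>x. (f has_real_derivative f' x) (at x)"
    and f'': "\<And>x. (f' has_real_derivative f'' x) (at x)"
    and "continuous_on UNIV f''"
  shows "C2_circle f" and "deriv f = f'" and "deriv (deriv f) = f''"
proof -
  show 1: "deriv f = f'"
    using f' DERIV_imp_deriv by blast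
  show 2: "deriv (deriv f) = f''"
    unfolding 1 using f'' DERIV_imp_deriv by blast
  show "C2_circle f"
    unfolding C2_circle_def 2 unfolding 1
    using assms real_differentiable_def by blast
qed

lemma space_circle: "sets \<mu> = sets circle_borel \<Longrightarrow> space \<mu> = {0..<1}"
  using sets_eq_imp_space_eq[of \<mu> circle_borel]
  by (simp add: circle_borel_def space_restrict_space)

lemma continuous_measurable_circle:
  fixes f :: "real \<Rightarrow> real"
  assumes "sets \<mu> = sets circle_borel" and "continuous_on UNIV f"
  shows "f \<in> borel_measurable \<mu>"
proof -
  have "f \<in> borel_measurable borel"
    using assms(2) by (rule borel_measurable_continuous_onI)
  then have "f \<in> borel_measurable circle_borel"
    unfolding circle_borel_def by (rule measurable_restrict_space1)
  then show ?thesis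
    using assms(1) measurable_cong_sets by blast
qed

text \<open>The space of \<open>\<mu>\<close> is \<open>{0..<1}\<close>, inside the compact interval
  \<open>{0..1}\<close> on which \<open>f\<close> is bounded; bounded measurable functions are
  integrable against a probability measure.\<close>

lemma integrable_circle:
  fixes f :: "real \<Rightarrow> real"
  assumes "prob_measure_circle \<mu>" and f: "continuous_on UNIV f"
  shows "integrable \<mu> f"
proof -
  interpret prob_space \<mu>
    using assms(1) by (simp add: prob_measure_circle_def)
  have s: "sets \<mu> = sets circle_borel"
    using assms(1) by (simp add: prob_measure_circle_def)
  have "compact (f ` {0..1})"
    using f by (intro compact_continuous_image) (auto intro: continuous_on_subset)
  then obtain B where "\<And>x. x \<in> {0..1} \<Longrightarrow> norm (f x) \<le> B"
    using compact_imp_bounded bounded_iff by (metis imageI)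
  then have "AE x in \<mu>. norm (f x) \<le> B"
    by (intro AE_I2) (auto simp: space_circle[OF s])
  then show ?thesis
    by (intro integrable_const_bound[of _ B] continuous_measurable_circle[OF s f])
qed

section \<open>Periodic differentiable functions separate measures\<close>

text \<open>Squaring removes the kink of the positive part; this makes bumps supported on an arc
  continuously differentiable.\<close>

lemma max_0_squared_deriv:
  "((\<lambda>y::real. (max 0 y)\<^sup>2) has_real_derivative 2 * max 0 y) (at y)"
proof (cases y "0::real" rule: linorder_cases)
  case less
  have "((\<lambda>y::real. 0) has_real_derivative 0) (at y)"
    by simp
  then have "((\<lambda>y::real. (max 0 y)\<^sup>2) has_real_derivative 0) (at y)"
    by (rule has_field_derivative_transform_within_open[of _ _ _ "{..<0}"]) (use less in auto)
  then show ?thesis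
    using less by simp
next
  case greater
  have "((\<lambda>y::real. y\<^sup>2) has_real_derivative 2 * y) (at y)"
    by (auto intro!: derivative_eq_intros)
  then have "((\<lambda>y::real. (max 0 y)\<^sup>2) has_real_derivative 2 * y) (at y)"
    by (rule has_field_derivative_transform_within_open[of _ _ _ "{0<..}"]) (use greater in auto)
  then show ?thesis
    using greater by simp
next
  case equal
  have "((\<lambda>h::real. (max 0 h)\<^sup>2 / h) \<longlongrightarrow> 0) (at 0)"
  proof (rule Lim_null_comparison)
    show "\<forall>\<^sub>F h::real in at 0. norm ((max 0 h)\<^sup>2 / h) \<le> \<bar>h\<bar>"
      by (intro always_eventually) (auto simp: max_def power2_eq_square)
    show "((\<lambda>h::real. \<bar>h\<bar>) \<longlongrightarrow> 0) (at 0)"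
      by real_asymp
  qed
  then show ?thesis
    using equal by (simp add: DERIV_def)
qed

text \<open>The map t / (1 + t), applied to \<open>t = n * h x\<close>, is 0 where \<open>h\<close>
  vanishes and tends to 1 where \<open>h\<close> is positive. It thus suffices to find a nonnegative
  periodic C1 function \<open>h\<close> that is positive exactly on the open arc.\<close>

lemma periodic_bump_converging_to_interval:
  fixes s :: real
  assumes s: "0 \<le> s" "s < 1"
  obtains g g' :: "nat \<Rightarrow> real \<Rightarrow> real"
  where "\<And>n x. g n (x + 1) = g n x"
    and "\<And>n x. (g n has_real_derivative g' n x) (at x)"
    and "\<And>n. continuous_on UNIV (g' n)"
    and "\<And>n x. \<bar>g n x\<bar> \<le> 1"
    and "\<And>x. x \<in> {0..<1} \<Longrightarrow> (\<lambda>n. g n x) \<longlonglongrightarrow> indicator {s<..<1} x"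
proof -
  \<comment> \<open>on the circle, \<open>k\<close> is positive exactly on the arc \<open>(s, 1)\<close>\<close>
  define k where "k x = sin (pi * x) * sin (pi * (x - s))" for x
  define k' where
    "k' x = pi * cos (pi * x) * sin (pi * (x - s)) + sin (pi * x) * (pi * cos (pi * (x - s)))" for x
  define h where "h x = (max 0 (k x))\<^sup>2" for x
  define h' where "h' x = 2 * max 0 (k x) * k' x" for x
  define g where "g n x = real n * h x / (1 + real n * h x)" for n x
  define g' where "g' n x = real n * h' x / (1 + real n * h x)\<^sup>2" for n x
  have h0: "h x \<ge> 0" for x
    by (simp add: h_def)
  have pos: "1 + real n * h x > 0" for n x
    using h0[of x] by (simp add: add_pos_nonneg)
  have k: "(k has_real_derivative k' x) (at x)" for x
    unfolding k_def k'_def by (auto intro!: derivative_eq_intros simp: algebra_simps)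
  have h: "(h has_real_derivative h' x) (at x)" for x
    using DERIV_chain2[OF max_0_squared_deriv k, of x] unfolding h_def h'_def by simp
  have ch: "continuous_on UNIV h"
    by (meson DERIV_isCont continuous_at_imp_continuous_on h)
  have per: "g n (x + 1) = g n x" for n x
  proof -
    \<comment> \<open>Both sines change sign under the shift by 1, so their product is
      invariant.\<close>
    have "k (x + 1) = k x"
      using sin_periodic_pi[of "pi * x"] sin_periodic_pi[of "pi * (x - s)"]
      by (simp add: k_def algebra_simps)
    then show ?thesis
      by (simp add: g_def h_def)
  qed
  have der: "(g n has_real_derivative g' n x) (at x)" for n x
    unfolding g_def g'_def using pos[of n x]
    by (auto intro!: derivative_eq_intros h simp: field_simps power2_eq_square)
  have cg': "continuous_on UNIV (g' n)" for n
  proof -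
    have "continuous_on UNIV h'"
      unfolding h'_def k'_def k_def by (intro continuous_intros)
    then show ?thesis
      unfolding g'_def
      using pos[of n] by (intro continuous_intros ch) (auto simp: less_le)
  qed
  have bd: "\<bar>g n x\<bar> \<le> 1" for n x
    using pos[of n x] h0[of x] by (simp add: g_def)
  have lim: "(\<lambda>n. g n x) \<longlonglongrightarrow> indicator {s<..<1} x" if x: "x \<in> {0..<1}" for x
  proof (cases "s < x")
    case True
    have "0 < sin (pi * x)" "0 < sin (pi * (x - s))"
      using True x s by (auto intro!: sin_gt_zero)
    then have "h x > 0"
      by (simp add: h_def k_def)
    then have "(\<lambda>n. real n * h x / (1 + real n * h x)) \<longlonglongrightarrow> 1"
      by real_asymp
    then show ?thesis
      using True x by (simp add: g_def)
  next
    case False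
    \<comment> \<open>To the left of \<open>s\<close> the second factor of \<open>k\<close> is
      nonpositive, so \<open>h x\<close> is 0 and the sequence is constantly 0.\<close>
    have "0 \<le> sin (pi * x)" "0 \<le> sin (pi * (s - x))"
      using False x s by (auto intro!: sin_ge_zero)
    moreover have "sin (pi * (x - s)) = - sin (pi * (s - x))"
      by (metis minus_diff_eq mult_minus_right sin_minus)
    ultimately have "k x \<le> 0"
      by (simp add: k_def)
    then show ?thesis
      using False by (simp add: g_def h_def)
  qed
  show ?thesis
    using that[of g g'] per der cg' bd lim by blast
qed

text \<open>Dominated convergence along the bumps turns equal integrals into equal masses of all
  arcs \<open>{t<..<1}\<close>. Their complements are the segments \<open>{0..t}\<close>, whose
  masses are the values of the distribution function.\<close>

lemma circle_measure_eqI: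
  assumes \<mu>: "prob_measure_circle \<mu>" and \<nu>: "prob_measure_circle \<nu>"
    and eq: "\<And>g g'. (\<And>x. g (x + 1) = g x) \<Longrightarrow>
      (\<And>x. (g has_real_derivative g' x) (at x)) \<Longrightarrow> continuous_on UNIV g' \<Longrightarrow>
      (LINT x|\<mu>. g x) = (LINT x|\<nu>. g x)"
  shows "\<mu> = \<nu>"
proof -
  have s: "sets \<mu> = sets circle_borel" "sets \<nu> = sets circle_borel"
    and "prob_space \<mu>" "prob_space \<nu>"
    using \<mu> \<nu> by (auto simp: prob_measure_circle_def)
  interpret M: prob_space \<mu> by fact
  interpret N: prob_space \<nu> by fact
  note sp = space_circle[OF s(1)] space_circle[OF s(2)]
  have int_ind: "(\<lambda>n. LINT x|\<rho>. g n x) \<longlonglongrightarrow> measure \<rho> {t<..<1}"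
    if \<rho>: "prob_measure_circle \<rho>" and t: "0 \<le> t"
      and g: "\<And>n. continuous_on UNIV (g n)" "\<And>n x. \<bar>g n x\<bar> \<le> 1"
        "\<And>x. x \<in> {0..<1} \<Longrightarrow> (\<lambda>n. g n x) \<longlonglongrightarrow> indicator {t<..<1} x"
    for \<rho> t and g :: "nat \<Rightarrow> real \<Rightarrow> real"
  proof -
    have s: "sets \<rho> = sets circle_borel" and "prob_space \<rho>"
      using \<rho> by (auto simp: prob_measure_circle_def)
    interpret R: prob_space \<rho> by fact
    have set: "{t<..<1} \<in> sets \<rho>"
      unfolding s circle_borel_def using t by (subst sets_restrict_space_iff) auto
    have "(\<lambda>n. LINT x|\<rho>. g n x) \<longlonglongrightarrow> (LINT x|\<rho>. indicator {t<..<1} x)"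
      using g set continuous_measurable_circle[OF s]
      by (intro integral_dominated_convergence[where w = "\<lambda>_. 1"])
        (auto simp: space_circle[OF s])
    then show ?thesis
      using set by simp
  qed
  have meas: "measure \<mu> {t<..<1} = measure \<nu> {t<..<1}" if t: "0 \<le> t" "t < 1" for t
  proof -
    obtain g g' where g: "\<And>n x. g n (x + 1) = g n x"
      "\<And>n x. (g n has_real_derivative g' n x) (at x)"
      "\<And>n. continuous_on UNIV (g' n)" "\<And>n x. \<bar>g n x\<bar> \<le> (1::real)"
      "\<And>x. x \<in> {0..<1} \<Longrightarrow> (\<lambda>n. g n x) \<longlonglongrightarrow> indicator {t<..<1} x"
      using periodic_bump_converging_to_interval[OF t] by metis
    have "continuous_on UNIV (g n)" for n
      by (meson DERIV_isCont continuous_at_imp_continuous_on g(2))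
    then have "(\<lambda>n. LINT x|\<mu>. g n x) \<longlonglongrightarrow> measure \<mu> {t<..<1}"
      "(\<lambda>n. LINT x|\<nu>. g n x) \<longlonglongrightarrow> measure \<nu> {t<..<1}"
      by (auto intro!: int_ind \<mu> \<nu> t(1) g(4,5))
    moreover have "(LINT x|\<mu>. g n x) = (LINT x|\<nu>. g n x)" for n
      using eq[of "g n" "g' n"] g by blast
    ultimately show ?thesis
      using LIMSEQ_unique by fastforce
  qed
  have id: "(\<lambda>x. x) \<in> measurable \<mu> borel" "(\<lambda>x. x) \<in> measurable \<nu> borel"
    using s by (auto intro!: continuous_measurable_circle continuous_intros)
  \<comment> \<open>\<open>cdf_unique\<close> concerns measures on the whole line, so each measure
    is pushed forward along the inclusion; all mass lies in \<open>{0..<1}\<close>, which fixes the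
    values for \<open>t < 0\<close> and \<open>t \<ge> 1\<close>.\<close>
  have cdf: "cdf (distr \<rho> borel (\<lambda>x. x)) t =
      (if t < 0 then 0 else if t < 1 then 1 - measure \<rho> {t<..<1} else 1)"
    if \<rho>: "prob_measure_circle \<rho>" for \<rho> t
  proof -
    have s: "sets \<rho> = sets circle_borel" and "prob_space \<rho>"
      using \<rho> by (auto simp: prob_measure_circle_def)
    interpret R: prob_space \<rho> by fact
    have set: "{t<..<1} \<in> sets \<rho>" if "0 \<le> t"
      unfolding s circle_borel_def using that by (subst sets_restrict_space_iff) auto
    have "(\<lambda>x. x) \<in> measurable \<rho> borel"
      using s by (auto intro!: continuous_measurable_circle continuous_intros)
    then have *: "cdf (distr \<rho> borel (\<lambda>x. x)) t = measure \<rho> ({..t} \<inter> {0..<1})"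
      by (simp add: cdf_def measure_distr space_circle[OF s])
    consider "t < 0" | "0 \<le> t" "t < 1" | "1 \<le> t"
      by linarith
    then show ?thesis
    proof cases
      case 1
      then have "{..t} \<inter> {0..<1} = {}"
        by auto
      then show ?thesis
        using 1 * by simp
    next
      case 2
      then have "{..t} \<inter> {0..<1} = space \<rho> - {t<..<1}"
        by (auto simp: space_circle[OF s])
      then show ?thesis
        using 2 * R.prob_compl[OF set] by simp
    next
      case 3
      then have "{..t} \<inter> {0..<1} = space \<rho>"
        by (auto simp: space_circle[OF s])
      then show ?thesis
        using 3 * R.prob_space by simp
    qed
  qed
  have "distr \<mu> borel (\<lambda>x. x) = distr \<nu> borel (\<lambda>x. x)"
  proof (rule cdf_unique)
    show "real_distribution (distr \<mu> borel (\<lambda>x. x))" "real_distribution (distr \<nu> borel (\<lambda>x. x))"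
      using id by (auto intro!: real_distribution.intro M.prob_space_distr N.prob_space_distr
          simp: real_distribution_axioms_def)
    show "cdf (distr \<mu> borel (\<lambda>x. x)) = cdf (distr \<nu> borel (\<lambda>x. x))"
      using meas by (auto simp: cdf[OF \<mu>] cdf[OF \<nu>])
  qed
  then have D: "emeasure (distr \<mu> borel (\<lambda>x. x)) A = emeasure (distr \<nu> borel (\<lambda>x. x)) A" for A
    by simp
  show ?thesis
  proof (rule measure_eqI)
    show "sets \<mu> = sets \<nu>"
      using s by simp
    fix A assume A: "A \<in> sets \<mu>"
    then have A': "A \<in> sets borel" "A \<subseteq> {0..<1}"
      by (auto simp: s circle_borel_def sets_restrict_space_iff)
    then show "emeasure \<mu> A = emeasure \<nu> A"
      using D[of A] by (simp add: emeasure_distr id sp Int_absorb2)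
  qed
qed


section \<open>The invariant measure of the drift\<close>

text \<open>For nonvanishing \<open>b\<close> the product \<open>b x * omega b x\<close> is
  constant, so this is the invariant probability measure of the flow x' = b(x) on the circle, the
  motion left when \<open>\<epsilon>\<close> is 0.\<close>

abbreviation omega_measure :: "(real \<Rightarrow> real) \<Rightarrow> real measure" where
  "omega_measure b \<equiv> density circle_lebesgue (\<lambda>s. ennreal (omega b s))"

text \<open>A continuous \<open>b\<close> without zeros keeps one sign, by connectedness of its
  range. The normalising integral has that same sign, so the quotient is positive in either
  case.\<close>

lemma omega_facts:
  assumes cont: "continuous_on UNIV b" and nz: "\<And>x. b x \<noteq> 0"
  shows "(LBINT u:{0..1}. 1 / b u) \<noteq> 0"
    and "omega b x > 0"
    and "continuous_on A (omega b)"
    and "integral {0..1} (omega b) = 1"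
proof -
  define Z where "Z = (LBINT u:{0..1}. 1 / b u)"
  have c: "continuous_on A (\<lambda>x. 1 / b x)" for A
    using nz by (intro continuous_intros continuous_on_subset[OF cont]) auto
  have Z: "Z = integral {0..1} (\<lambda>x. 1 / b x)"
    unfolding Z_def
    by (rule set_borel_integral_eq_integral(2)[OF borel_integrable_atLeastAtMost'[OF c]])
  have conn: "connected (range b)"
    using cont by (rule connected_continuous_image) simp
  have sign: "(\<forall>x. b x > 0) \<or> (\<forall>x. b x < 0)"
  proof (rule ccontr)
    assume "\<not> ?thesis"
    then obtain x y where "b x \<le> 0" "0 \<le> b y"
      by (meson not_less)
    then have "0 \<in> range b"
      using connectedD_interval[OF conn] by blast
    then show False
      using nz by (metis imageE)
  qed
  have pos: "Z * (1 / b x) > 0" for x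
    using sign
  proof
    assume b: "\<forall>x. b x > 0"
    have "Z \<ge> 0"
      unfolding Z using b by (intro integral_nonneg integrable_continuous_real c) (simp add: less_imp_le)
    \<comment> \<open>A nonnegative continuous function with integral 0 vanishes on the whole
      interval, which fails at the point 0.\<close>
    moreover have "Z \<noteq> 0"
      unfolding Z using b nz
      by (subst integral_eq_0_iff) (auto intro: c simp: less_imp_le intro!: bexI[of _ 0])
    ultimately show ?thesis
      using b by simp
  next
    assume b: "\<forall>x. b x < 0"
    have Z': "- Z = integral {0..1} (\<lambda>x. - (1 / b x))"
      unfolding Z by simp
    have "- Z \<ge> 0"
      unfolding Z' using b
      by (intro integral_nonneg integrable_continuous_real continuous_intros c) (simp add: less_imp_le)
    moreover have "- Z \<noteq> 0"
      unfolding Z' using b nz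
      by (subst integral_eq_0_iff)
        (auto intro: c continuous_on_minus simp: less_imp_le intro!: bexI[of _ 0])
    ultimately show ?thesis
      using b by (simp add: divide_neg_neg)
  qed
  show Z0: "(LBINT u:{0..1}. 1 / b u) \<noteq> 0"
    using pos[of 0] unfolding Z_def by auto
  have om: "omega b = (\<lambda>x. 1 / b x / Z)"
    by (simp add: omega_def Z_def fun_eq_iff)
  show "omega b x > 0"
    using pos[of x] unfolding om by (metis zero_less_divide_iff zero_less_mult_iff)
  show "continuous_on A (omega b)"
    unfolding om using Z0 by (intro continuous_intros c) (simp add: Z_def)
  show "integral {0..1} (omega b) = 1"
    unfolding om using Z0[folded Z_def] by (subst integral_divide) (simp add: Z[symmetric])
qed

text \<open>Measures live on the half-open domain, while the fundamental theorem of calculus is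
  applied on \<open>{0..1}\<close>; the added endpoint is negligible.\<close>

lemma
  fixes f :: "real \<Rightarrow> real"
  assumes f: "continuous_on UNIV f"
  shows integral_circle_lebesgue: "(LINT x|circle_lebesgue. f x) = integral {0..1} f"
    and integrable_circle_lebesgue: "integrable circle_lebesgue f"
proof -
  have "set_integrable lborel {0..1} f"
    by (intro borel_integrable_atLeastAtMost' continuous_on_subset[OF f]) simp
  then have i: "set_integrable lborel {0..<1} f"
    by (rule set_integrable_subset) auto
  then show "integrable circle_lebesgue f"
    by (simp add: circle_lebesgue_def integrable_restrict_space set_integrable_def)
  have "(LINT x|circle_lebesgue. f x) = (LINT x:{0..<1}|lborel. f x)"
    by (simp add: circle_lebesgue_def integral_restrict_space set_lebesgue_integral_def)
  also have "\<dots> = integral {0..<1} f"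
    by (rule set_borel_integral_eq_integral(2)[OF i])
  also have "\<dots> = integral {0..1} f"
    by (rule integral_spike_set) (auto intro: negligible_subset[of "{1}"])
  finally show "(LINT x|circle_lebesgue. f x) = integral {0..1} f" .
qed

lemma sets_circle_lebesgue: "sets circle_lebesgue = sets circle_borel"
  by (simp add: circle_lebesgue_def circle_borel_def sets_restrict_space)

lemma
  assumes b: "continuous_on UNIV b" "\<And>x. b x \<noteq> 0"
  shows prob_omega_measure: "prob_measure_circle (omega_measure b)"
    and integral_omega_measure: "continuous_on UNIV f \<Longrightarrow>
      (LINT x|omega_measure b. f x) = integral {0..1} (\<lambda>x. omega b x * f x)"
proof -
  note om = omega_facts[OF b]
  have m: "g \<in> borel_measurable circle_lebesgue" if "continuous_on UNIV g" for g :: "real \<Rightarrow> real"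
    using continuous_measurable_circle[OF sets_circle_lebesgue that] .
  have "emeasure (omega_measure b) (space (omega_measure b)) = (\<integral>\<^sup>+ x. ennreal (omega b x) \<partial>circle_lebesgue)"
    using m[OF om(3)] by (subst emeasure_density) (auto intro!: nn_integral_cong)
  also have "\<dots> = ennreal (LINT x|circle_lebesgue. omega b x)"
    by (intro nn_integral_eq_integral integrable_circle_lebesgue om(3)) (simp add: om(2) less_imp_le)
  also have "\<dots> = 1"
    by (simp add: integral_circle_lebesgue[OF om(3)] om(4))
  finally show "prob_measure_circle (omega_measure b)"
    by (simp add: prob_measure_circle_def prob_spaceI sets_circle_lebesgue)
  show "(LINT x|omega_measure b. f x) = integral {0..1} (\<lambda>x. omega b x * f x)"
    if f: "continuous_on UNIV f"
    by (subst integral_density)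
      (auto intro!: m f om(3) integral_circle_lebesgue continuous_on_mult simp: om(2) less_imp_le)
qed

section \<open>Upper bound at the invariant measure\<close>

text \<open>With \<open>v = u' / u\<close>, \<open>p = a \<omega>\<close> and \<open>c = b \<omega>\<close> (a constant), the integrand equals
  \<open>- (\<epsilon> p (v' + v\<^sup>2) + c v) = - (\<epsilon> p v + c ln u)' + \<epsilon> (p' v - p v\<^sup>2)\<close>: the first term
  integrates to 0 over a period, and the second is maximised at \<open>v = p' / (2 p)\<close>.\<close>

lemma I_eps_omega_measure_le:
  assumes b: "continuous_on UNIV b" "\<And>x. b x \<noteq> 0" "\<And>x. b (x + 1) = b x"
    and a: "continuous_on UNIV a" "\<And>x. a x > 0" "\<And>x. a (x + 1) = a x"
    and p': "\<And>x. ((\<lambda>x. a x * omega b x) has_real_derivative p' x) (at x)"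
    and K: "\<And>x. x \<in> {0..1} \<Longrightarrow> (p' x)\<^sup>2 / (4 * (a x * omega b x)) \<le> K"
    and \<epsilon>: "\<epsilon> > 0"
  shows "I_eps a b \<epsilon> (omega_measure b) \<le> ereal (\<epsilon> * K)"
  unfolding I_eps_def
proof (rule SUP_least)
  fix u assume "u \<in> {u. C2_circle u \<and> (\<forall>x. u x > 0)}"
  then have u: "C2_circle u" and upos: "\<And>x. u x > 0"
    by auto
  note om = omega_facts[OF b(1,2)]
  note u' = C2_circleD[OF u]
  define c where "c = 1 / (LBINT u:{0..1}. 1 / b u)"
  define p where "p x = a x * omega b x" for x
  define v where "v x = deriv u x / u x" for x
  define w where "w x = deriv (deriv u) x / u x" for x
  define F where "F x = - (\<epsilon> * (p x * v x) + c * ln (u x))" for x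
  define G where "G x = - (\<epsilon> * (p' x * v x + p x * (w x - (v x)\<^sup>2)) + c * v x)" for x
  have bom: "b x * omega b x = c" for x
    using b(2)[of x] by (simp add: omega_def c_def)
  have p: "p x > 0" for x
    using om(2)[of x] a(2)[of x] by (simp add: p_def)
  \<comment> \<open>The Riccati identity for the logarithmic derivative:
    \<open>w = v' + v\<^sup>2\<close>.\<close>
  have v: "(v has_real_derivative w x - (v x)\<^sup>2) (at x)" for x
    unfolding v_def w_def using upos[of x] u'(2,3)
    by (auto intro!: derivative_eq_intros simp: field_simps power2_eq_square)
  have lnu: "((\<lambda>x. ln (u x)) has_real_derivative v x) (at x)" for x
    unfolding v_def using upos[of x] by (auto intro!: derivative_eq_intros u'(2))
  have "(F has_real_derivative G x) (at x)" for x
    unfolding F_def G_def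
    by (rule DERIV_cong[OF DERIV_minus[OF DERIV_add[OF DERIV_cmult[OF
              DERIV_mult[OF p'[folded p_def] v]] DERIV_cmult[OF lnu]]]])
      (simp add: algebra_simps)
  then have "(G has_integral (F 1 - F 0)) {0..1}"
    by (intro fundamental_theorem_of_calculus)
      (auto simp: has_real_derivative_iff_has_vector_derivative[symmetric]
        intro: has_field_derivative_at_within)
  \<comment> \<open>Periodicity of \<open>a\<close>, \<open>b\<close>, \<open>u\<close> and
    \<open>deriv u\<close> makes \<open>F\<close> agree at both ends, so the exact derivative
    \<open>G\<close> integrates to 0.\<close>
  moreover have "F 1 = F 0"
    using u'(1)[of 0] periodic_deriv[of u 0, OF u'(1)] a(3)[of 0] b(3)[of 0]
    by (simp add: F_def p_def v_def omega_def)
  ultimately have G: "(G has_integral 0) {0..1}"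
    by simp
  define f where "f x = (\<epsilon> * a x * deriv (deriv u) x + b x * deriv u x) / u x" for x
  have f: "continuous_on UNIV f"
    unfolding f_def using upos
    by (intro continuous_intros a(1) b(1) u') (auto simp: less_le)
  have le: "- (omega b x * f x) \<le> G x + \<epsilon> * K" if x: "x \<in> {0..1}" for x
  proof -
    have "omega b x * f x = \<epsilon> * p x * w x + (b x * omega b x) * v x"
      using upos[of x] by (simp add: f_def p_def w_def v_def field_simps)
    then have eq: "- (omega b x * f x) = G x + \<epsilon> * (p' x * v x - p x * (v x)\<^sup>2)"
      unfolding bom G_def by (simp add: algebra_simps)
    \<comment> \<open>Completing the square in \<open>v x\<close> leaves a maximum that no longer
      depends on \<open>u\<close>, hence a bound uniform over all test functions.\<close>
    have "(p' x)\<^sup>2 / (4 * p x) - (p' x * v x - p x * (v x)\<^sup>2) = (p' x - 2 * p x * v x)\<^sup>2 / (4 * p x)"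
      using p[of x] by (simp add: field_simps power2_eq_square)
    also have "\<dots> \<ge> 0"
      using p[of x] by simp
    finally have "p' x * v x - p x * (v x)\<^sup>2 \<le> K"
      using K[OF x] by (simp add: p_def)
    then show ?thesis
      unfolding eq using \<epsilon> by simp
  qed
  have "((\<lambda>x. omega b x * f x) has_integral integral {0..1} (\<lambda>x. omega b x * f x)) {0..1}"
    by (intro integrable_integral integrable_continuous_real continuous_intros om(3)
        continuous_on_subset[OF f]) simp
  then have 1: "((\<lambda>x. - (omega b x * f x)) has_integral - integral {0..1} (\<lambda>x. omega b x * f x)) {0..1}"
    by (rule has_integral_neg)
  have 2: "((\<lambda>x. G x + \<epsilon> * K) has_integral (0 + \<epsilon> * K)) {0..1}"
    using has_integral_add[OF G has_integral_const_real[of "\<epsilon> * K" 0 1]] by simp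
  have "- integral {0..1} (\<lambda>x. omega b x * f x) \<le> \<epsilon> * K"
    using has_integral_le[OF 1 2 le] by simp
  then show "ereal (- (LINT x|omega_measure b. (\<epsilon> * a x * deriv (deriv u) x + b x * deriv u x) / u x))
      \<le> ereal (\<epsilon> * K)"
    using integral_omega_measure[OF b(1,2) f] by (simp add: f_def)
qed

lemma I_eps_nonneg: "0 \<le> I_eps a b \<epsilon> \<mu>"
proof -
  have d: "deriv (\<lambda>x::real. 1::real) = (\<lambda>x. 0)" "deriv (\<lambda>x::real. 0::real) = (\<lambda>x. 0)"
    by simp_all
  have "C2_circle (\<lambda>x. 1)"
    by (simp add: C2_circle_def d)
  then show ?thesis
    unfolding I_eps_def by (intro SUP_upper2[of "\<lambda>x. 1"]) (simp_all add: d)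
qed

section \<open>Divergence at every other measure\<close>

text \<open>The test function \<open>\<phi>\<close> solves \<open>b \<phi>' = g - \<integral> g \<omega> ds\<close>, for some \<open>g\<close> which \<open>\<mu>\<close> and
  \<open>\<omega> ds\<close> integrate differently; it is periodic because the right-hand side has mean 0
  against \<open>\<omega> ds\<close>.\<close>

lemma ex_test_function:
  assumes b: "C2_circle b" "\<And>x. b x \<noteq> 0"
    and \<mu>: "prob_measure_circle \<mu>" "\<mu> \<noteq> omega_measure b"
  obtains \<phi> where "C2_circle \<phi>" "(LINT x|\<mu>. b x * deriv \<phi> x) \<noteq> 0"
proof -
  note b' = C2_circleD[OF b(1)]
  note om = omega_facts[OF b'(4) b(2)]
  interpret M: prob_space \<mu>
    using \<mu>(1) by (simp add: prob_measure_circle_def)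
  obtain g g' where per: "\<And>x. g (x + 1) = g x"
    and g: "\<And>x. (g has_real_derivative g' x) (at x)" and g': "continuous_on UNIV g'"
    and ne: "(LINT x|\<mu>. g x) \<noteq> (LINT x|omega_measure b. g x)"
    using circle_measure_eqI[OF \<mu>(1) prob_omega_measure[OF b'(4) b(2)]] \<mu>(2) by metis
  define c where "c = (LINT x|omega_measure b. g x)"
  define h where "h x = (g x - c) / b x" for x
  define h' where "h' x = (g' x * b x - (g x - c) * deriv b x) / (b x)\<^sup>2" for x
  have cg: "continuous_on A g" for A
    by (meson DERIV_isCont continuous_at_imp_continuous_on g)
  have h: "(h has_real_derivative h' x) (at x)" for x
    unfolding h_def h'_def using b(2)[of x]
    by (auto intro!: derivative_eq_intros g b'(2) simp: power2_eq_square)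
  have h': "continuous_on UNIV h'"
    unfolding h'_def using b(2) by (intro continuous_intros g' cg b') auto
  have ch: "continuous_on A h" for A
    by (meson DERIV_isCont continuous_at_imp_continuous_on h)
  have perh: "h (x + 1) = h x" for x
    by (simp add: h_def per b'(1))
  have inth: "integral {0..1} h = 0"
  proof -
    define Z where "Z = (LBINT u:{0..1}. 1 / b u)"
    \<comment> \<open>Since \<open>1 / b\<close> is \<open>Z\<close> times \<open>omega b\<close>,
      the integral of \<open>h\<close> over a period is \<open>Z\<close> times the mean of
      \<open>g - c\<close> against \<open>omega_measure b\<close>, which is 0 by the choice of
      \<open>c\<close>.\<close>
    have "h x = Z * (omega b x * g x - c * omega b x)" for x
      using om(1) b(2)[of x] by (simp add: h_def omega_def Z_def[symmetric] field_simps)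
    then have "h = (\<lambda>x. Z * (omega b x * g x - c * omega b x))"
      by blast
    then have "integral {0..1} h = Z * integral {0..1} (\<lambda>x. omega b x * g x - c * omega b x)"
      by simp
    also have "integral {0..1} (\<lambda>x. omega b x * g x - c * omega b x) =
        integral {0..1} (\<lambda>x. omega b x * g x) - c * integral {0..1} (omega b)"
      by (subst integral_diff) (auto intro!: integrable_continuous_real continuous_intros om(3) cg)
    also have "\<dots> = 0"
      using om(4) integral_omega_measure[OF b'(4) b(2) cg] by (simp add: c_def)
    finally show ?thesis
      by simp
  qed
  obtain \<phi> where \<phi>: "\<And>x. (\<phi> has_real_derivative h x) (at x)"
  proof -
    have "\<exists>\<phi>. \<forall>x. (\<phi> has_vector_derivative h x) (at x)"
      using einterval_antiderivative[of "- \<infinity>" \<infinity> h] DERIV_isCont[OF h] by simp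
    then show ?thesis
      using that by (auto simp: has_real_derivative_iff_has_vector_derivative)
  qed
  \<comment> \<open>The increment of \<open>\<phi>\<close> over one period is constant because its
    derivative \<open>h\<close> is periodic, and it equals the integral of \<open>h\<close> over
    \<open>{0..1}\<close>, which is 0.\<close>
  have per\<phi>: "\<phi> (x + 1) = \<phi> x" for x
  proof -
    have "((\<lambda>x. \<phi> (x + 1) - \<phi> x) has_real_derivative 0) (at x)" for x
      using DERIV_shift[of \<phi> "h x" x 1] \<phi>[of "x + 1"] \<phi>[of x] perh[of x]
      by (auto intro!: derivative_eq_intros)
    then have "\<phi> (x + 1) - \<phi> x = \<phi> (0 + 1) - \<phi> 0"
      using DERIV_isconst_all[of "\<lambda>x. \<phi> (x + 1) - \<phi> x" x 0] by blast
    moreover have "(h has_integral (\<phi> 1 - \<phi> 0)) {0..1}"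
      by (intro fundamental_theorem_of_calculus)
        (auto simp: has_real_derivative_iff_has_vector_derivative[symmetric]
          intro: has_field_derivative_at_within \<phi>)
    ultimately show ?thesis
      using inth by (simp add: integral_unique)
  qed
  note C2 = C2_circleI[OF per\<phi> \<phi> h h']
  have "(LINT x|\<mu>. b x * deriv \<phi> x) = (LINT x|\<mu>. g x - c)"
    using b(2) by (simp add: C2(2) h_def)
  also have "\<dots> = (LINT x|\<mu>. g x) - c"
    using integrable_circle[OF \<mu>(1) cg] by (simp add: M.prob_space)
  also have "\<dots> \<noteq> 0"
    using ne by (simp add: c_def)
  finally show ?thesis
    using that C2(1) by blast
qed

text \<open>For \<open>u = exp (l * \<phi>)\<close> the quotients of both derivatives by
  \<open>u\<close> involve only derivatives of \<open>\<phi>\<close>, so the functional is affine in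
  \<open>\<epsilon>\<close> with value \<open>- l * k\<close> at 0. As \<open>k\<close> is nonzero,
  a suitable \<open>l\<close> of either sign makes this as large as desired.\<close>

lemma I_eps_tendsto_infinity:
  assumes b: "C2_circle b" "\<And>x. b x \<noteq> 0" and a: "continuous_on UNIV a"
    and \<mu>: "prob_measure_circle \<mu>" "\<mu> \<noteq> omega_measure b"
  shows "((\<lambda>\<epsilon>. I_eps a b \<epsilon> \<mu>) \<longlongrightarrow> \<infinity>) (at_right 0)"
  unfolding tendsto_PInfty
proof
  fix M :: real
  obtain \<phi> where \<phi>: "C2_circle \<phi>" and k0: "(LINT x|\<mu>. b x * deriv \<phi> x) \<noteq> 0"
    using ex_test_function[OF b \<mu>] by blast
  note b' = C2_circleD[OF b(1)] and \<phi>' = C2_circleD[OF \<phi>]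
  define k where "k = (LINT x|\<mu>. b x * deriv \<phi> x)"
  \<comment> \<open>Chosen so that \<open>- l * k = M + 1\<close>; the extra 1 absorbs
    \<open>\<epsilon> * C\<close> once \<open>\<epsilon>\<close> is small.\<close>
  define l where "l = - (M + 1) / k"
  \<comment> \<open>The quotient of the second derivative of \<open>exp (l * \<phi>)\<close> by the
    function itself.\<close>
  define q where "q x = l * deriv (deriv \<phi>) x + (l * deriv \<phi> x)\<^sup>2" for x
  define C where "C = (LINT x|\<mu>. a x * q x)"
  define u where "u x = exp (l * \<phi> x)" for x
  define u' where "u' x = l * deriv \<phi> x * u x" for x
  define u'' where "u'' x = q x * u x" for x
  have du: "(u has_real_derivative u' x) (at x)" for x
    unfolding u_def u'_def by (auto intro!: derivative_eq_intros \<phi>'(2))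
  have du': "(u' has_real_derivative u'' x) (at x)" for x
    unfolding u'_def[abs_def] u''_def q_def
    by (auto intro!: derivative_eq_intros \<phi>'(3) du simp: u'_def algebra_simps power2_eq_square)
  have cq: "continuous_on UNIV q"
    unfolding q_def by (intro continuous_intros \<phi>')
  have "continuous_on UNIV u''"
    unfolding u''_def u_def by (intro continuous_intros cq \<phi>')
  note C2 = C2_circleI[OF _ du du' this]
  have per: "u (x + 1) = u x" for x
    by (simp add: u_def \<phi>'(1))
  have val: "(LINT x|\<mu>. (\<epsilon> * a x * deriv (deriv u) x + b x * deriv u x) / u x) = \<epsilon> * C + l * k" for \<epsilon>
  proof -
    have "(\<epsilon> * a x * deriv (deriv u) x + b x * deriv u x) / u x =
        \<epsilon> * (a x * q x) + l * (b x * deriv \<phi> x)" for x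
    proof -
      have "u x \<noteq> 0"
        by (simp add: u_def)
      then show ?thesis
        unfolding C2(3)[OF per] unfolding C2(2)[OF per] by (simp add: u''_def u'_def field_simps)
    qed
    moreover have "integrable \<mu> (\<lambda>x. a x * q x)" "integrable \<mu> (\<lambda>x. b x * deriv \<phi> x)"
      by (auto intro!: integrable_circle[OF \<mu>(1)] continuous_intros a cq b' \<phi>')
    ultimately show ?thesis
      by (simp add: C_def k_def)
  qed
  have ge: "I_eps a b \<epsilon> \<mu> \<ge> ereal (M + 1 - \<epsilon> * C)" for \<epsilon>
    unfolding I_eps_def
  proof (rule SUP_upper2[of u])
    show "u \<in> {u. C2_circle u \<and> (\<forall>x. u x > 0)}"
      using C2(1)[OF per] by (simp add: u_def)
    have "l * k = - (M + 1)"
      using k0 by (simp add: l_def k_def)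
    then show "ereal (M + 1 - \<epsilon> * C) \<le>
        ereal (- (LINT x|\<mu>. (\<epsilon> * a x * deriv (deriv u) x + b x * deriv u x) / u x))"
      unfolding val by simp
  qed
  have "((\<lambda>\<epsilon>. M + 1 - \<epsilon> * C) \<longlongrightarrow> M + 1 - 0 * C) (at_right 0)"
    by (intro tendsto_intros)
  then have "\<forall>\<^sub>F \<epsilon> in at_right 0. M < M + 1 - \<epsilon> * C"
    by (rule order_tendstoD(1)) simp
  then show "\<forall>\<^sub>F \<epsilon> in at_right 0. ereal M < I_eps a b \<epsilon> \<mu>"
    by (rule eventually_mono) (metis ge less_ereal.simps(1) less_le_trans)
qed

section \<open>Limits as the noise vanishes\<close>

text \<open>The rate is squeezed between 0 and \<open>\<epsilon> * K\<close>, where \<open>K\<close>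
  is finite because the bounding quotient is continuous on the compact interval
  \<open>{0..1}\<close>.\<close>

lemma I_eps_omega_measure_tendsto_0:
  assumes b: "C2_circle b" "\<And>x. b x \<noteq> 0"
    and a: "\<And>x. (a has_real_derivative a' x) (at x)" "continuous_on UNIV a'"
      "\<And>x. a x > 0" "\<And>x. a (x + 1) = a x"
  shows "((\<lambda>\<epsilon>. I_eps a b \<epsilon> (omega_measure b)) \<longlongrightarrow> 0) (at_right 0)"
proof -
  note b' = C2_circleD[OF b(1)]
  note om = omega_facts[OF b'(4) b(2)]
  define Z where "Z = (LBINT u:{0..1}. 1 / b u)"
  \<comment> \<open>The product rule with \<open>omega b = 1 / (Z * b)\<close>; only first
    derivatives of \<open>a\<close> and \<open>b\<close> enter, so \<open>p'\<close> is
    continuous.\<close>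
  define p' where "p' x = a' x * omega b x - a x * (deriv b x / (b x)\<^sup>2 / Z)" for x
  have om': "omega b = (\<lambda>x. 1 / b x / Z)"
    by (simp add: omega_def Z_def fun_eq_iff)
  have dp: "((\<lambda>x. a x * omega b x) has_real_derivative p' x) (at x)" for x
    unfolding p'_def om' using b(2)[of x] om(1)[folded Z_def]
    by (auto intro!: derivative_eq_intros a(1) b'(2) simp: field_simps power2_eq_square)
  have ca: "continuous_on A a" for A
    by (meson DERIV_isCont continuous_at_imp_continuous_on a(1))
  have p0: "a x * omega b x > 0" for x
    using a(3) om(2) by simp
  have "continuous_on UNIV p'"
    unfolding p'_def using b(2) om(1)[folded Z_def]
    by (intro continuous_intros a(2) om(3) ca b') auto
  then have "continuous_on UNIV (\<lambda>x. (p' x)\<^sup>2 / (4 * (a x * omega b x)))"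
    using p0 by (intro continuous_intros ca om(3)) (auto simp: less_le)
  then have "compact ((\<lambda>x. (p' x)\<^sup>2 / (4 * (a x * omega b x))) ` {0..1})"
    by (intro compact_continuous_image) (auto intro: continuous_on_subset)
  then obtain K where K: "\<And>x. x \<in> {0..1} \<Longrightarrow> norm ((p' x)\<^sup>2 / (4 * (a x * omega b x))) \<le> K"
    using compact_imp_bounded bounded_iff by (metis (no_types, lifting) imageI)
  have K': "(p' x)\<^sup>2 / (4 * (a x * omega b x)) \<le> K" if "x \<in> {0..1}" for x
    using K[OF that] by (simp only: real_norm_def abs_le_iff)
  have "((\<lambda>\<epsilon>. \<epsilon> * K) \<longlongrightarrow> 0 * K) (at_right 0)"
    by (intro tendsto_intros)
  then have lim: "((\<lambda>\<epsilon>. ereal (\<epsilon> * K)) \<longlongrightarrow> 0) (at_right 0)"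
    by (simp add: zero_ereal_def)
  have "\<forall>\<^sub>F \<epsilon> in at_right 0. I_eps a b \<epsilon> (omega_measure b) \<le> ereal (\<epsilon> * K)"
    using eventually_at_right_less[of "0::real"]
  proof eventually_elim
    case (elim \<epsilon>)
    show ?case
      by (rule I_eps_omega_measure_le[OF b'(4) b(2) b'(1) ca a(3,4) dp K' elim])
  qed
  then show ?thesis
    by (intro tendsto_sandwich[OF _ _ tendsto_const lim]) (simp_all add: I_eps_nonneg)
qed

theorem proposition3p4:
  fixes \<sigma> b a :: "real \<Rightarrow> real" and \<mu> :: "real measure"
  assumes "C2_circle \<sigma>" and "C2_circle b"
    and "\<And>x. a x = (\<sigma> x)\<^sup>2 / 2"
    and "\<And>x. a x > 0"
    and "\<And>x. b x \<noteq> 0"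
    and "prob_measure_circle \<mu>"
  shows "((\<lambda>\<epsilon>. I_eps a b \<epsilon> \<mu>) \<longlongrightarrow> I_lim a b \<mu>) (at_right 0) \<and>
         0 \<le> I_lim a b \<mu> \<and>
         I_lim a b \<mu> =
           (if \<mu> = density circle_lebesgue (\<lambda>s. ennreal (omega b s)) then 0 else \<infinity>)"
proof -
  note \<sigma>' = C2_circleD[OF assms(1)]
  have a: "a = (\<lambda>x. (\<sigma> x)\<^sup>2 / 2)"
    using assms(3) by blast
  have da: "(a has_real_derivative \<sigma> x * deriv \<sigma> x) (at x)" for x
    unfolding a by (auto intro!: derivative_eq_intros \<sigma>'(2))
  have ca: "continuous_on UNIV a" "continuous_on UNIV (\<lambda>x. \<sigma> x * deriv \<sigma> x)"
    unfolding a by (intro continuous_intros \<sigma>' | simp)+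
  have "a (x + 1) = a x" for x
    by (simp add: a \<sigma>'(1))
  then have lim: "((\<lambda>\<epsilon>. I_eps a b \<epsilon> \<mu>) \<longlongrightarrow> (if \<mu> = omega_measure b then 0 else \<infinity>)) (at_right 0)"
    using I_eps_omega_measure_tendsto_0[OF assms(2,5) da ca(2) assms(4)]
      I_eps_tendsto_infinity[OF assms(2,5) ca(1) assms(6)] by simp
  \<comment> \<open>\<open>Lim\<close> is a definite description, so its value is read off from the
    limit just proved; limits along the nontrivial filter \<open>at_right 0\<close> are
    unique.\<close>
  then have "I_lim a b \<mu> = (if \<mu> = omega_measure b then 0 else \<infinity>)"
    unfolding I_lim_def by (intro tendsto_Lim) simp_all
  then show ?thesis
    using lim by simp
qed

end
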